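(* Let $d \geq 1$, let $X \subset \mathbb{Z}^d$ be a non-empty finite fully convex set, and let $Z \subset \mathrm{Vtcs}(\mathrm{CvxH}(X))$ be a subset of the vertices of its convex hull. Assume that for every $i \in \{1,\ldots,d\}$ and every $z \in Z$, we have $\{z - \mathbf{e}_i,\, z + \mathbf{e}_i\} \cap (X \setminus Z) \neq \emptyset$. Then $X \setminus Z$ is fully convex.
   Context: An open cell of the cubical complex of $\mathbb{R}^d$ induced by $\mathbb{Z}^d$ is a product $c = c_1 \times \cdots \times c_d$ where each $c_j$ is either a singleton $\{a\}$ or an open interval $(a,a+1)$ with $a \in \mathbb{Z}$; it is a $k$-cell if exactly $k$ of the factors are open intervals. For $Y \subset \mathbb{R}^d$ and $0 \le k \le d$, let $\bar{\mathcal{C}}^d_k[Y]$ be the set of $k$-cells whose topological closure in $\mathbb{R}^d$ meets $Y$. Let $\mathrm{CvxH}(Y)$ be the convex hull of $Y$ in $\mathbb{R}^d$. A set $X \subset \mathbb{Z}^d$ is fully convex if $\bar{\mathcal{C}}^d_k[X] = \bar{\mathcal{C}}^d_k[\mathrm{CvxH}(X)]$ for all $k$ with $0 \le k \le d$. $\mathrm{Vtcs}(P)$ denotes the set of extreme points (vertices) of a polytope $P$, and $\mathbf{e}_i$ is the $i$-th canonical basis vector of $\mathbb{R}^d$. *)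

theory Defs
  imports "HOL-Analysis.Analysis"
begin

definition int_lattice :: "(real ^ 'n) set" where
  "int_lattice = {x. \<forall>i. x $ i \<in> \<int>}"

definition is_singleton_factor :: "real set \<Rightarrow> bool" where
  "is_singleton_factor I \<longleftrightarrow> (\<exists>a::int. I = {of_int a})"

definition is_open_factor :: "real set \<Rightarrow> bool" where
  "is_open_factor I \<longleftrightarrow> (\<exists>a::int. I = {of_int a <..< of_int a + 1})"

definition open_cell :: "nat \<Rightarrow> (real ^ 'n) set \<Rightarrow> bool" where
  "open_cell k c \<longleftrightarrow>
     (\<exists>F :: 'n \<Rightarrow> real set.
        (\<forall>j. is_singleton_factor (F j) \<or> is_open_factor (F j)) \<and>
        card {j. is_open_factor (F j)} = k \<and>
        c = {x. \<forall>j. x $ j \<in> F j})"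

definition touching_cells :: "nat \<Rightarrow> (real ^ 'n) set \<Rightarrow> (real ^ 'n) set set" where
  "touching_cells k Y = {c. open_cell k c \<and> closure c \<inter> Y \<noteq> {}}"

definition fully_convex :: "(real ^ 'n) set \<Rightarrow> bool" where
  "fully_convex X \<longleftrightarrow>
     X \<subseteq> int_lattice \<and>
     (\<forall>k \<le> CARD('n). touching_cells k X = touching_cells k (convex hull X))"

definition vtcs :: "(real ^ 'n) set \<Rightarrow> (real ^ 'n) set" where
  "vtcs P = {x. x extreme_point_of P}"

end

theory Submission
  imports Defs
begin

text \<open>Let a closed cell \<open>C\<close> meet the convex hull of \<open>X - Z\<close> in a point \<open>p\<close>. By full convexity of \<open>X\<close>,
  \<open>C\<close> contains some \<open>z \<in> X\<close>. If \<open>C\<close> missed \<open>X - Z\<close>, then \<open>z \<in> Z\<close>, and for each coordinate \<open>i\<close> with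
  \<open>p\<^sub>i \<noteq> z\<^sub>i\<close> the neighbour of \<open>z\<close> on the side of \<open>p\<close> would lie in \<open>C\<close>, so the opposite neighbour would
  belong to \<open>X - Z\<close>. A suitable average of these opposite neighbours is the point on the ray from \<open>p\<close>
  through \<open>z\<close> beyond \<open>z\<close>, whence \<open>z\<close> lies in the convex hull of \<open>X - Z\<close>, contradicting extremality.\<close>

text \<open>Convergence in a finite product is coordinatewise, so sequences chosen in the separate
  factors assemble into one of vectors.\<close>

lemma closure_vec_box:
  fixes F :: "'n::finite \<Rightarrow> 'a::real_normed_vector set"
  shows "closure {x. \<forall>j. x $ j \<in> F j} = {x. \<forall>j. x $ j \<in> closure (F j)}"
proof (rule equalityI)
  have "closed {x :: 'a ^ 'n. \<forall>j. x $ j \<in> closure (F j)}"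
    by (intro closed_Collect_all closed_vimage_vec_nth[unfolded vimage_def] closed_closure)
  then show "closure {x. \<forall>j. x $ j \<in> F j} \<subseteq> {x. \<forall>j. x $ j \<in> closure (F j)}"
    using closure_subset by (intro closure_minimal) fast+
next
  show "{x. \<forall>j. x $ j \<in> closure (F j)} \<subseteq> closure {x. \<forall>j. x $ j \<in> F j}"
  proof
    fix x :: "'a ^ 'n" assume "x \<in> {x. \<forall>j. x $ j \<in> closure (F j)}"
    then have x: "\<And>j. x $ j \<in> closure (F j)" by simp
    show "x \<in> closure {x. \<forall>j. x $ j \<in> F j}"
    proof (unfold closure_sequential)
      have "\<forall>j. \<exists>f. (\<forall>n. f n \<in> F j) \<and> f \<longlonglongrightarrow> x $ j"
        using x unfolding closure_sequential by blast
      then obtain f where f: "\<And>j n. f j n \<in> F j" "\<And>j. f j \<longlonglongrightarrow> x $ j"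
        by metis
      have "(\<lambda>n. \<chi> j. f j n) \<longlonglongrightarrow> x"
        by (rule vec_tendstoI) (simp add: f(2))
      then show "\<exists>g. (\<forall>n. g n \<in> {x. \<forall>j. x $ j \<in> F j}) \<and> g \<longlonglongrightarrow> x"
        using f(1) by (intro exI[of _ "\<lambda>n. \<chi> j. f j n"]) simp
    qed
  qed
qed

text \<open>Two distinct points rule out a singleton. The only integers in
  \<open>{a .. a + 1}\<close> are its endpoints, so a unit step from \<open>z\<close> towards
  \<open>p\<close> ends at the other endpoint.\<close>

lemma integer_step_in_closure_factor:
  assumes "is_singleton_factor I \<or> is_open_factor I"
    and "p \<in> closure I" and "z \<in> closure I" and "z \<in> \<int>" and "p \<noteq> z"
  shows "z + sgn (p - z) \<in> closure I"
proof -
  have "\<not> is_singleton_factor I"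
    using assms unfolding is_singleton_factor_def by auto
  then obtain a :: int where "I = {of_int a <..< of_int a + 1}"
    using assms(1) unfolding is_open_factor_def by blast
  then have I: "closure I = {of_int a .. of_int a + 1}" by simp
  obtain m :: int where m: "z = of_int m" using assms(4) by (auto elim: Ints_cases)
  have "m = a \<or> m = a + 1"
    using assms(3) unfolding I m by simp linarith
  then show ?thesis
    using assms(2,5) unfolding I m by (auto simp: sgn_if)
qed

lemma open_cell_closure_step:
  fixes p z :: "real ^ 'n"
  assumes "open_cell k c" and "p \<in> closure c" and "z \<in> closure c" and "z \<in> int_lattice"
    and "p $ i \<noteq> z $ i"
  shows "z + axis i (sgn (p $ i - z $ i)) \<in> closure c"
proof -
  obtain F where F: "\<And>j. is_singleton_factor (F j) \<or> is_open_factor (F j)"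
    and "c = {x. \<forall>j. x $ j \<in> F j}"
    using assms(1) unfolding open_cell_def by blast
  then have c: "closure c = {x. \<forall>j. x $ j \<in> closure (F j)}"
    by (simp only: closure_vec_box)
  have "z $ i + sgn (p $ i - z $ i) \<in> closure (F i)"
    by (rule integer_step_in_closure_factor[OF F])
      (use assms(2-5) in \<open>simp_all add: c int_lattice_def\<close>)
  then show ?thesis
    using assms(3) unfolding c by (simp add: axis_def)
qed

lemma convex_mem_if_opposite_neighbours:
  fixes p z :: "real ^ 'n"
  assumes "convex S" and p: "p \<in> S"
    and nb: "\<And>i. p $ i \<noteq> z $ i \<Longrightarrow> z - axis i (sgn (p $ i - z $ i)) \<in> S"
  shows "z \<in> S"
proof (cases "p = z")
  case False
  \<comment> \<open>Where \<open>p\<close> and \<open>z\<close> agree, the weight below is zero; the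
    value \<open>p\<close> only keeps \<open>v i\<close> inside \<open>S\<close>.\<close>
  define v where "v i = (if p $ i = z $ i then p else z - axis i (sgn (p $ i - z $ i)))" for i
  \<comment> \<open>The l1-distance from \<open>p\<close> to \<open>z\<close> normalises the
    weights.\<close>
  define s where "s = (\<Sum>i\<in>UNIV. \<bar>p $ i - z $ i\<bar>)"
  obtain i where "p $ i \<noteq> z $ i" using False by (auto simp: vec_eq_iff)
  then have s: "s > 0" unfolding s_def by (intro sum_pos2[of _ i]) auto
  have "(\<Sum>i\<in>UNIV. (\<bar>p $ i - z $ i\<bar> / s) *\<^sub>R v i) \<in> S" (is "?q \<in> S")
  proof (rule convex_sum)
    show "(\<Sum>i\<in>UNIV. \<bar>p $ i - z $ i\<bar> / s) = 1"
      using s by (simp add: s_def flip: sum_divide_distrib)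
  qed (use s assms in \<open>auto simp: v_def\<close>)
  \<comment> \<open>Since |t| sgn t = t, weighting the unit steps recovers the coordinates of
    \<open>p - z\<close>.\<close>
  have "(\<bar>p $ i - z $ i\<bar> / s) *\<^sub>R v i = (\<bar>p $ i - z $ i\<bar> / s) *\<^sub>R z - (1 / s) *\<^sub>R axis i ((p - z) $ i)" for i
    using s by (auto simp: v_def vec_eq_iff axis_def sgn_if field_simps)
  then have "?q = (\<Sum>i\<in>UNIV. \<bar>p $ i - z $ i\<bar> / s) *\<^sub>R z - (1 / s) *\<^sub>R (\<Sum>i\<in>UNIV. axis i ((p - z) $ i))"
    by (simp add: sum_subtractf scaleR_sum_left scaleR_sum_right)
  also have "(\<Sum>i\<in>UNIV. axis i ((p - z) $ i)) = p - z"
    by (simp add: vec_eq_iff axis_def)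
  also have "(\<Sum>i\<in>UNIV. \<bar>p $ i - z $ i\<bar> / s) = 1"
    using s by (simp add: s_def flip: sum_divide_distrib)
  finally have q: "?q = z - (1 / s) *\<^sub>R (p - z)" by simp
  \<comment> \<open>As p - z = s (z - q), the point \<open>z\<close> divides the segment from
    \<open>p\<close> to q in the ratio s : 1.\<close>
  have "z = (1 / (1 + s)) *\<^sub>R p + (s / (1 + s)) *\<^sub>R ?q"
    unfolding q using s by (simp add: vec_eq_iff divide_simps) (simp add: algebra_simps)
  also have "\<dots> \<in> S"
    using s by (intro convexD[OF assms(1) p \<open>?q \<in> S\<close>]) (auto simp: divide_simps)
  finally show ?thesis .
qed (use p in simp)

text \<open>Removing an extreme point leaves the hull of \<open>X\<close> convex, and this smaller
  convex set still contains \<open>Y\<close>.\<close>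

lemma extreme_point_notin_convex_hull:
  assumes "z extreme_point_of (convex hull X)" and "Y \<subseteq> X" and "z \<notin> Y"
  shows "z \<notin> convex hull Y"
proof -
  have "convex (convex hull X - {z})"
    using assms(1) by (simp add: extreme_point_of_stillconvex)
  moreover have "Y \<subseteq> convex hull X - {z}"
    using assms(2,3) hull_subset[of X convex] by blast
  ultimately have "convex hull Y \<subseteq> convex hull X - {z}"
    by (rule hull_minimal[rotated])
  then show ?thesis by blast
qed

theorem theorem2:
  fixes X Z :: "(real ^ 'n) set"
  assumes "X \<noteq> {}" and "finite X" and "fully_convex X"
    and "Z \<subseteq> vtcs (convex hull X)"
    and "\<forall>i::'n. \<forall>z\<in>Z. {z - axis i 1, z + axis i 1} \<inter> (X - Z) \<noteq> {}"
  shows "fully_convex (X - Z)"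
proof -
  have lat: "X \<subseteq> int_lattice"
    and full: "\<And>k. k \<le> CARD('n) \<Longrightarrow> touching_cells k X = touching_cells k (convex hull X)"
    using assms(3) unfolding fully_convex_def by auto
  \<comment> \<open>Only this direction needs work: a cell touching \<open>X - Z\<close> touches its
    hull by monotonicity.\<close>
  have "closure c \<inter> (X - Z) \<noteq> {}"
    if k: "k \<le> CARD('n)" and c: "open_cell k c" and "p \<in> closure c" "p \<in> convex hull (X - Z)"
    for k c p
  proof
    assume empty: "closure c \<inter> (X - Z) = {}"
    have "p \<in> convex hull X" using that(4) hull_mono[of "X - Z" X convex] by blast
    then have "c \<in> touching_cells k X"
      using full[OF k] c that(3) unfolding touching_cells_def by blast
    then obtain z where z: "z \<in> closure c" "z \<in> X" unfolding touching_cells_def by blast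
    then have "z \<in> Z" using empty by blast
    have "z \<in> convex hull (X - Z)"
    proof (rule convex_mem_if_opposite_neighbours[OF convex_convex_hull that(4)])
      fix i assume ne: "p $ i \<noteq> z $ i"
      have "z + axis i (sgn (p $ i - z $ i)) \<in> closure c"
        using open_cell_closure_step[OF c that(3) z(1) _ ne] z(2) lat by blast
      then have "z + axis i (sgn (p $ i - z $ i)) \<notin> X - Z" using empty by blast
      moreover have "z - axis i 1 \<in> X - Z \<or> z + axis i 1 \<in> X - Z"
        using assms(5) \<open>z \<in> Z\<close> by blast
      \<comment> \<open>This matches a step of sign -1 with the neighbours
        \<open>z - axis i 1\<close> and \<open>z + axis i 1\<close> of the hypothesis.\<close>
      moreover have "axis i (- 1) = - axis i (1 :: real)" by (simp add: vec_eq_iff axis_def)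
      ultimately have "z - axis i (sgn (p $ i - z $ i)) \<in> X - Z"
        using ne by (auto simp: sgn_if split: if_splits)
      then show "z - axis i (sgn (p $ i - z $ i)) \<in> convex hull (X - Z)" by (rule hull_inc)
    qed
    moreover have "z \<notin> convex hull (X - Z)"
      using assms(4) \<open>z \<in> Z\<close> by (intro extreme_point_notin_convex_hull[of z X]) (auto simp: vtcs_def)
    ultimately show False by blast
  qed
  then have "touching_cells k (X - Z) = touching_cells k (convex hull (X - Z))"
    if "k \<le> CARD('n)" for k
    using that hull_subset[of "X - Z" convex] unfolding touching_cells_def by blast
  then show ?thesis using lat unfolding fully_convex_def by blast
qed

end
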